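(* Suppose $\mathbb{Z}^D=\Gamma_1\oplus\Gamma_2\oplus\cdots\oplus\Gamma_r\oplus\Lambda$ is a direct sum decomposition into subgroups, and for $i=1,\dots,r$ let $\mathbf X_i=(X_i,\Sigma_i,\mu_i,T_i)\in\mathsf Z_0^{\Gamma_i}$ be $\mathsf C_i$-sated, where \[\mathsf C_i:=\bigvee_{j\le r,\,j\ne i}\mathsf Z_0^{\Gamma_i+\Gamma_j}.\] Then for any joining $\pi_i:\mathbf Y=(Y,\Phi,\nu,S)\to\mathbf X_i$, $i=1,\dots,r$, the $\sigma$-algebras $\pi_i^{-1}(\Sigma_i)$ are relatively independent under $\nu$ over \[\pi_i^{-1}\Big(\bigvee_{j\le r,\,j\ne i}\Sigma_i^{T_i\upharpoonright(\Gamma_i+\Gamma_j)}\Big),\quad i=1,\dots,r.\]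
   Context: $\mathbb{Z}^D$-systems: standard Borel probability spaces with measure-preserving $\mathbb{Z}^D$-actions. For $\Lambda\le\mathbb{Z}^D$: $\Sigma^{T\upharpoonright\Lambda}=\{A:\mu(A\triangle T^\gamma A)=0\ \forall\gamma\in\Lambda\}$; $\mathsf Z_0^\Lambda$ is the class of systems with $T^\gamma=\mathrm{id}$ for $\gamma\in\Lambda$. A joining of $\mathbf X_1,\dots,\mathbf X_r$ is a system with factor maps onto each whose pulled-back $\sigma$-algebras generate everything; the join $\mathsf C_1\vee\cdots\vee\mathsf C_m$ of classes is the class of all joinings of members of the $\mathsf C_j$. Sub-$\sigma$-algebras $\Sigma'_i\supseteq\Xi_i$ are relatively independent over $(\Xi_i)$ under $\nu$ if $\int\prod_i f_i\,d\nu=\int\prod_i\mathsf E_\nu(f_i\mid\Xi_i)\,d\nu$ for all bounded $\Sigma'_i$-measurable $f_i$. For an idempotent class $\mathsf C$ (contains trivial system, closed under isomorphism, joinings, inverse limits), $\zeta^{\mathbf X}_{\mathsf C}$ coordinatizes the maximal factor in $\mathsf C$, and $\mathbf X$ is $\mathsf C$-sated if for every extension $\pi:\tilde{\mathbf X}\to\mathbf X$ and $f\in L^\infty(\mu)$, $\mathsf E(f\circ\pi\mid\zeta^{\tilde{\mathbf X}}_{\mathsf C})=\mathsf E(f\mid\zeta^{\mathbf X}_{\mathsf C})\circ\pi$. *)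

theory Defs
  imports "HOL-Probability.Probability"
begin

type_synonym ('a, 'd) sys = "'a measure \<times> ((int ^ 'd) \<Rightarrow> 'a \<Rightarrow> 'a)"

text \<open>Standard Borel measurable space: Borel-isomorphic to a Borel subset of the reals
  (Kuratowski), with its Borel sigma-algebra.\<close>
definition standard_borel :: "'a measure \<Rightarrow> bool" where
  "standard_borel M \<longleftrightarrow>
     (\<exists>B \<in> sets (borel :: real measure). \<exists>f. bij_betw f (space M) B
        \<and> f \<in> M \<rightarrow>\<^sub>M restrict_space borel B
        \<and> the_inv_into (space M) f \<in> restrict_space borel B \<rightarrow>\<^sub>M M)"

definition zsystem :: "('a, 'd::finite) sys \<Rightarrow> bool" where
  "zsystem X \<longleftrightarrow> prob_space (fst X) \<and> standard_borel (fst X)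
     \<and> (\<forall>g. snd X g \<in> fst X \<rightarrow>\<^sub>M fst X \<and> distr (fst X) (fst X) (snd X g) = fst X)
     \<and> (\<forall>x \<in> space (fst X). snd X 0 x = x)
     \<and> (\<forall>g h. \<forall>x \<in> space (fst X). snd X (g + h) x = snd X g (snd X h x))"

definition factor_map :: "('b, 'd::finite) sys \<Rightarrow> ('a, 'd) sys \<Rightarrow> ('b \<Rightarrow> 'a) \<Rightarrow> bool" where
  "factor_map Y X p \<longleftrightarrow> p \<in> fst Y \<rightarrow>\<^sub>M fst X \<and> distr (fst Y) (fst X) p = fst X
     \<and> (\<forall>g. AE y in fst Y. p (snd Y g y) = snd X g (p y))"

definition is_subgroup :: "(int ^ 'd::finite) set \<Rightarrow> bool" where
  "is_subgroup G \<longleftrightarrow> 0 \<in> G \<and> (\<forall>a\<in>G. \<forall>b\<in>G. a + b \<in> G) \<and> (\<forall>a\<in>G. - a \<in> G)"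

definition direct_sum_decomp :: "nat \<Rightarrow> (nat \<Rightarrow> (int ^ 'd::finite) set) \<Rightarrow> (int ^ 'd) set \<Rightarrow> bool" where
  "direct_sum_decomp r \<Gamma> \<Lambda> \<longleftrightarrow> (\<forall>i<r. is_subgroup (\<Gamma> i)) \<and> is_subgroup \<Lambda>
     \<and> (\<forall>v. \<exists>!(g, l). (\<forall>i<r. g i \<in> \<Gamma> i) \<and> (\<forall>i\<ge>r. g i = 0) \<and> l \<in> \<Lambda>
                        \<and> v = (\<Sum>i<r. g i) + l)"

definition gsum :: "(int ^ 'd::finite) set \<Rightarrow> (int ^ 'd) set \<Rightarrow> (int ^ 'd) set" where
  "gsum A B = {a + b | a b. a \<in> A \<and> b \<in> B}"

definition in_Z0 :: "(int ^ 'd::finite) set \<Rightarrow> ('a, 'd) sys \<Rightarrow> bool" where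
  "in_Z0 L X \<longleftrightarrow> (\<forall>\<gamma>\<in>L. AE x in fst X. snd X \<gamma> x = x)"

definition inv_sets :: "('a, 'd::finite) sys \<Rightarrow> (int ^ 'd) set \<Rightarrow> 'a set set" where
  "inv_sets X L = {A \<in> sets (fst X). \<forall>\<gamma>\<in>L.
      measure (fst X) ((A - (snd X \<gamma> -` A \<inter> space (fst X))) \<union> ((snd X \<gamma> -` A \<inter> space (fst X)) - A)) = 0}"

definition is_joining :: "('b, 'd::finite) sys \<Rightarrow> nat set \<Rightarrow> (nat \<Rightarrow> ('a, 'd) sys) \<Rightarrow> (nat \<Rightarrow> 'b \<Rightarrow> 'a) \<Rightarrow> bool" where
  "is_joining Y J X p \<longleftrightarrow> zsystem Y \<and> (\<forall>i\<in>J. zsystem (X i) \<and> factor_map Y (X i) (p i))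
     \<and> (\<forall>A \<in> sets (fst Y). \<exists>B \<in> sigma_sets (space (fst Y))
            (\<Union>i\<in>J. {p i -` S \<inter> space (fst Y) | S. S \<in> sets (fst (X i))}).
          measure (fst Y) ((A - B) \<union> (B - A)) = 0)"

text \<open>The class Z_0^{L j_1} \<or> ... \<or> Z_0^{L j_k} (j ranging over J), as a predicate on systems.
  Systems are represented on the universal carrier type real (every standard Borel
  system is isomorphic to one on a Borel subset of the reals).\<close>
definition Z0_join :: "nat set \<Rightarrow> (nat \<Rightarrow> (int ^ 'd::finite) set) \<Rightarrow> (real, 'd) sys \<Rightarrow> bool" where
  "Z0_join J L Z \<longleftrightarrow> (\<exists>(W :: nat \<Rightarrow> (real, 'd) sys) p.
       (\<forall>j\<in>J. in_Z0 (L j) (W j)) \<and> is_joining Z J W p)"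

definition zeta :: "((real, 'd::finite) sys \<Rightarrow> bool) \<Rightarrow> ('a, 'd) sys \<Rightarrow> 'a measure" where
  "zeta C X = sigma (space (fst X))
     (\<Union>{ {p -` S \<inter> space (fst X) | S. S \<in> sets (fst Z)} | Z p.
           zsystem Z \<and> C Z \<and> factor_map X Z p })"

definition sated :: "((real, 'd::finite) sys \<Rightarrow> bool) \<Rightarrow> ('a, 'd) sys \<Rightarrow> bool" where
  "sated C X \<longleftrightarrow> (\<forall>Xt :: (real, 'd) sys. \<forall>\<pi> :: real \<Rightarrow> 'a. zsystem Xt \<and> factor_map Xt X \<pi> \<longrightarrow>
     (\<forall>f :: 'a \<Rightarrow> real. f \<in> borel_measurable (fst X) \<and> (\<exists>B. \<forall>x\<in>space (fst X). \<bar>f x\<bar> \<le> (B::real)) \<longrightarrow>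
        (AE x in fst Xt. real_cond_exp (fst Xt) (zeta C Xt) (f \<circ> \<pi>) x
                          = real_cond_exp (fst X) (zeta C X) f (\<pi> x))))"

definition rel_indep :: "'b measure \<Rightarrow> nat set \<Rightarrow> (nat \<Rightarrow> 'b measure) \<Rightarrow> (nat \<Rightarrow> 'b measure) \<Rightarrow> bool" where
  "rel_indep M J Sig Xi \<longleftrightarrow> (\<forall>f :: nat \<Rightarrow> 'b \<Rightarrow> real.
     (\<forall>i\<in>J. f i \<in> borel_measurable (Sig i) \<and> (\<exists>B. \<forall>x\<in>space M. \<bar>f i x\<bar> \<le> B)) \<longrightarrow>
       (\<integral>x. (\<Prod>i\<in>J. f i x) \<partial>M) = (\<integral>x. (\<Prod>i\<in>J. real_cond_exp M (Xi i) (f i) x) \<partial>M))"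

definition C_class :: "nat \<Rightarrow> (nat \<Rightarrow> (int ^ 'd::finite) set) \<Rightarrow> nat \<Rightarrow> (real, 'd) sys \<Rightarrow> bool" where
  "C_class r \<Gamma> i = Z0_join ({..<r} - {i}) (\<lambda>j. gsum (\<Gamma> i) (\<Gamma> j))"

end

theory Submission
  imports Defs
begin

text \<open>
  Fix \<open>i\<close> and let \<open>P\<close> be the projection of the acting group that kills \<open>\<Gamma> i\<close> and fixes the other
  summands. Composing every action with \<open>P\<close> does not change \<open>X i\<close>, on which \<open>\<Gamma> i\<close> acts trivially
  anyway, so the joining with its modified action is still an extension of \<open>X i\<close>; but each \<open>X j\<close>
  with \<open>j \<noteq> i\<close> becomes a factor on which \<open>\<Gamma> i + \<Gamma> j\<close> acts trivially. Hence all the functions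
  lifted from these \<open>X j\<close> are measurable with respect to the maximal \<open>C_class r \<Gamma> i\<close>-factor of this
  extension, and satedness allows the function lifted from \<open>X i\<close> to be replaced by its conditional
  expectation under the integral. Doing this for one index after the other gives the theorem.

  Only one inclusion between the maximal \<open>C_class r \<Gamma> i\<close>-factor of \<open>X i\<close> and the \<open>\<sigma>\<close>-algebra
  generated by the partially invariant sets is needed: if \<open>\<psi>\<close> is the conditional expectation of
  \<open>\<phi>\<close> on the larger one, then both have the same conditional expectation on the smaller one.
\<close>

section \<open>Projections of the acting group\<close>

text \<open>\<open>P v\<close> is \<open>v\<close> minus its component in \<open>\<Gamma> i\<close>;
  taking components is additive because decompositions are unique. The three properties obtained are
  the ones through which the change of action is carried out.\<close>

lemma direct_sum_decomp_projection:
  assumes dec: "direct_sum_decomp r \<Gamma> \<Lambda>" and i: "i < r"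
  obtains P where "\<And>g h. P (g + h) = P g + P h" and "\<And>g. g - P g \<in> \<Gamma> i"
    and "\<And>j a b. j < r \<Longrightarrow> j \<noteq> i \<Longrightarrow> a \<in> \<Gamma> i \<Longrightarrow> b \<in> \<Gamma> j \<Longrightarrow> P (a + b) = b"
proof -
  define R where "R v x \<longleftrightarrow> (\<forall>i<r. fst x i \<in> \<Gamma> i) \<and> (\<forall>i\<ge>r. fst x i = 0) \<and> snd x \<in> \<Lambda>
      \<and> v = (\<Sum>i<r. fst x i) + snd x" for v and x :: "(nat \<Rightarrow> int ^ 'a) \<times> (int ^ 'a)"
  have sub: "\<And>i. i < r \<Longrightarrow> is_subgroup (\<Gamma> i)" "is_subgroup \<Lambda>"
    and ex1: "\<exists>!x. R v x" for v
    using dec unfolding direct_sum_decomp_def R_def by (auto simp: case_prod_unfold)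
  define c where "c v = (THE x. R v x)" for v
  have c: "R v (c v)" for v
    unfolding c_def by (rule theI'[OF ex1])
  have c_eq: "c v = x" if "R v x" for v x
    using ex1[of v] c[of v] that by blast
  define Q where "Q v = fst (c v) i" for v
  have Q_add: "Q (v + w) = Q v + Q w" for v w
  proof -
    \<comment> \<open>Adding components gives a decomposition of \<open>v + w\<close>, which by
      uniqueness is the chosen one.\<close>
    have "R (v + w) (\<lambda>k. fst (c v) k + fst (c w) k, snd (c v) + snd (c w))"
      using c[of v] c[of w] sub unfolding R_def is_subgroup_def
      by (simp add: sum.distrib algebra_simps)
    from c_eq[OF this] show ?thesis by (simp add: Q_def)
  qed
  have Q_single: "Q b = (if j = i then b else 0)" if "j < r" "b \<in> \<Gamma> j" for j b
  proof -
    have "R b ((\<lambda>k. if k = j then b else 0), 0)"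
      using that sub unfolding R_def is_subgroup_def by auto
    from c_eq[OF this] show ?thesis by (simp add: Q_def)
  qed
  have Q_mem: "Q v \<in> \<Gamma> i" for v
    using c[of v] i by (simp add: R_def Q_def)
  show ?thesis
  proof (rule that[of "\<lambda>v. v - Q v"])
    fix j a b assume "j < r" "j \<noteq> i" "a \<in> \<Gamma> i" "b \<in> \<Gamma> j"
    then show "a + b - Q (a + b) = b"
      using i by (simp add: Q_add Q_single[of i a] Q_single[of j b])
  qed (simp_all add: Q_add Q_mem)
qed

section \<open>Equality modulo null sets and conditional expectations\<close>

text \<open>\<open>inv_sets\<close> and \<open>is_joining\<close> express equality modulo null sets
  by symmetric differences of measure zero; the arguments below work with almost-everywhere
  equivalences.\<close>

lemma (in finite_measure) measure_sym_diff_eq_0_iff: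
  assumes "A \<in> sets M" "B \<in> sets M"
  shows "measure M ((A - B) \<union> (B - A)) = 0 \<longleftrightarrow> (AE x in M. x \<in> A \<longleftrightarrow> x \<in> B)"
proof -
  have "measure M ((A - B) \<union> (B - A)) = 0 \<longleftrightarrow> (A - B) \<union> (B - A) \<in> null_sets M"
    using assms by (auto simp: null_sets_def emeasure_eq_measure)
  also have "\<dots> \<longleftrightarrow> (AE x in M. x \<notin> (A - B) \<union> (B - A))"
    using assms by (intro AE_iff_null_sets) auto
  also have "\<dots> \<longleftrightarrow> (AE x in M. x \<in> A \<longleftrightarrow> x \<in> B)"
    by (intro AE_cong) auto
  finally show ?thesis .
qed

text \<open>Doob-Dynkin factorization: the sublevel set of \<open>f\<close> at each rational
  \<open>q\<close> is the preimage of some \<open>A q\<close>, and a value is recovered as the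
  infimum of the rationals whose \<open>A q\<close> contains the point.\<close>

lemma borel_measurable_vimage_algebra_factor:
  fixes f :: "'b \<Rightarrow> real"
  assumes f: "f \<in> borel_measurable (vimage_algebra Y p N)" and p: "p \<in> Y \<rightarrow> space N"
  obtains \<phi> :: "'a \<Rightarrow> real" where "\<phi> \<in> borel_measurable N" and "\<And>y. y \<in> Y \<Longrightarrow> f y = \<phi> (p y)"
proof -
  have "\<exists>A\<in>sets N. {y \<in> Y. f y < real_of_rat q} = p -` A \<inter> Y" for q
  proof -
    have "{y \<in> Y. f y < real_of_rat q} \<in> sets (vimage_algebra Y p N)"
      using f by (simp add: borel_measurable_iff_less)
    then show ?thesis
      by (auto simp: sets_vimage_algebra2[OF p])
  qed
  then obtain A where A: "\<And>q. A q \<in> sets N" 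
      "\<And>q. {y \<in> Y. f y < real_of_rat q} = p -` A q \<inter> Y"
    by metis
  \<comment> \<open>A point outside the image of \<open>p\<close> may lie in no \<open>A q\<close>,
    or in \<open>A q\<close> for arbitrarily small \<open>q\<close>, so the infimum is taken in the
    extended reals. On the image it is finite, and returning to the reals loses nothing.\<close>
  define \<psi> where "\<psi> x = (INF q. if x \<in> A q then ereal (real_of_rat q) else \<infinity>)" for x
  have [measurable]: "A q \<in> sets N" for q by (rule A)
  have "\<psi> \<in> borel_measurable N"
    unfolding \<psi>_def by measurable
  moreover have "\<psi> (p y) = ereal (f y)" if "y \<in> Y" for y
  proof -
    have iff: "p y \<in> A q \<longleftrightarrow> f y < real_of_rat q" for q
      using A(2)[of q] that by blast
    show ?thesis
      unfolding \<psi>_def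
    proof (rule antisym)
      show "ereal (f y) \<le> (INF q. if p y \<in> A q then ereal (real_of_rat q) else \<infinity>)"
        by (intro INF_greatest) (auto simp: iff)
      show "(INF q. if p y \<in> A q then ereal (real_of_rat q) else \<infinity>) \<le> ereal (f y)"
      proof (rule dense_ge)
        fix z assume "ereal (f y) < z"
        then obtain t where t: "f y < t" "ereal t < z"
          using ereal_dense2[of "ereal (f y)" z] by auto
        obtain q where "f y < real_of_rat q" "real_of_rat q < t"
          using of_rat_dense[OF t(1)] by blast
        then have q: "f y < real_of_rat q" "ereal (real_of_rat q) < z"
          using t(2) by (auto intro: less_trans[of _ "ereal t"])
        show "(INF q. if p y \<in> A q then ereal (real_of_rat q) else \<infinity>) \<le> z"
          by (rule INF_lower2[of q]) (use q iff in auto)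
      qed
    qed
  qed
  ultimately show ?thesis
    by (intro that[of "\<lambda>x. real_of_ereal (\<psi> x)"]) auto
qed

lemma (in finite_measure) set_integral_cong_sym_diff:
  fixes f :: "'a \<Rightarrow> real"
  assumes "AE x in M. x \<in> A \<longleftrightarrow> x \<in> B" "A \<in> sets M" "B \<in> sets M" "f \<in> borel_measurable M"
  shows "(\<integral>x\<in>A. f x \<partial>M) = (\<integral>x\<in>B. f x \<partial>M)"
  unfolding set_lebesgue_integral_def
  using assms by (intro integral_cong_AE) (auto simp: indicator_def)

text \<open>Tower property when \<open>F\<close> lies in \<open>G\<close> only up to null sets:
  replacing \<open>A\<close> in \<open>F\<close> by an equivalent \<open>B\<close> in
  \<open>G\<close> changes no set integral, and over \<open>B\<close> the integrals of
  \<open>f\<close> and \<open>g\<close> agree because \<open>g\<close> is a version of the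
  conditional expectation on \<open>G\<close>.\<close>

lemma real_cond_exp_coarser_mod_null:
  fixes f g :: "'a \<Rightarrow> real"
  assumes "finite_measure M" and F: "subalgebra M F" and G: "subalgebra M G"
    and FG: "\<And>A. A \<in> sets F \<Longrightarrow> \<exists>B\<in>sets G. AE x in M. x \<in> A \<longleftrightarrow> x \<in> B"
    and f: "integrable M f" and g: "integrable M g"
    and fg: "AE x in M. g x = real_cond_exp M G f x"
  shows "AE x in M. real_cond_exp M F f x = real_cond_exp M F g x"
proof -
  interpret finite_measure M by fact
  interpret F: finite_measure_subalgebra M F by unfold_locales (rule F)
  interpret G: finite_measure_subalgebra M G by unfold_locales (rule G)
  show ?thesis
  proof (rule F.real_cond_exp_charact)
    fix A assume A: "A \<in> sets F"
    obtain B where B: "B \<in> sets G" "AE x in M. x \<in> A \<longleftrightarrow> x \<in> B"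
      using FG[OF A] by blast
    have meas [measurable]: "A \<in> sets M" "B \<in> sets M" "f \<in> borel_measurable M" "g \<in> borel_measurable M"
      using A B F G f g by (auto simp: subalgebra_def)
    have "(\<integral>x\<in>A. f x \<partial>M) = (\<integral>x\<in>B. f x \<partial>M)"
      using B by (intro set_integral_cong_sym_diff) auto
    also have "\<dots> = (\<integral>x\<in>B. real_cond_exp M G f x \<partial>M)"
      by (rule G.real_cond_exp_intA[OF f B(1)])
    also have "\<dots> = (\<integral>x\<in>B. g x \<partial>M)"
      unfolding set_lebesgue_integral_def using fg by (intro integral_cong_AE) auto
    also have "\<dots> = (\<integral>x\<in>A. g x \<partial>M)"
      using B by (intro set_integral_cong_sym_diff[symmetric]) auto
    also have "\<dots> = (\<integral>x\<in>A. real_cond_exp M F g x \<partial>M)"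
      by (rule F.real_cond_exp_intA[OF g A])
    finally show "(\<integral>x\<in>A. f x \<partial>M) = (\<integral>x\<in>A. real_cond_exp M F g x \<partial>M)" .
  qed (auto intro: f g)
qed

text \<open>Sets of the pulled-back sigma-algebra are preimages of sets of \<open>F\<close>, so a
  change of variables turns the set integrals characterizing the conditional expectation on
  \<open>M\<close> into those on \<open>N\<close>.\<close>

lemma real_cond_exp_vimage_algebra:
  fixes \<phi> :: "'a \<Rightarrow> real"
  assumes M: "prob_space M" and p: "p \<in> M \<rightarrow>\<^sub>M N" "distr M N p = N"
    and F: "subalgebra N F" and \<phi>: "integrable N \<phi>"
  shows "AE y in M. real_cond_exp M (vimage_algebra (space M) p F) (\<lambda>y. \<phi> (p y)) y
           = real_cond_exp N F \<phi> (p y)"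
proof -
  interpret M: prob_space M by fact
  interpret N: prob_space N using M.prob_space_distr[OF p(1)] p(2) by simp
  have pF: "p \<in> M \<rightarrow>\<^sub>M F"
    using measurable_from_subalg p(1) F unfolding subalgebra_def
    by (auto simp: measurable_def)
  have "subalgebra M (vimage_algebra (space M) p F)"
    using sets_image_in_sets[OF refl pF] by (simp add: subalgebra_def)
  then interpret V: finite_measure_subalgebra M "vimage_algebra (space M) p F"
    by unfold_locales
  interpret F: finite_measure_subalgebra N F by unfold_locales (rule F)
  note [measurable] = p(1)
  have pull: "integrable M (\<lambda>y. u (p y))" if "integrable N u" for u :: "'a \<Rightarrow> real"
    using integrable_distr[OF p(1), of u] p(2) that by simp
  have psp: "p \<in> space M \<rightarrow> space F"
    using measurable_space[OF pF] by auto
  have set_int: "(\<integral>y\<in>p -` B \<inter> space M. u (p y) \<partial>M) = (\<integral>x\<in>B. u x \<partial>N)"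
    if "B \<in> sets N" "u \<in> borel_measurable N" for B and u :: "'a \<Rightarrow> real"
  proof -
    have "(\<integral>x\<in>B. u x \<partial>N) = (\<integral>x\<in>B. u x \<partial>distr M N p)"
      by (simp add: p(2))
    also have "\<dots> = (\<integral>y. indicator B (p y) *\<^sub>R u (p y) \<partial>M)"
      unfolding set_lebesgue_integral_def using that
      by (subst integral_distr) auto
    also have "\<dots> = (\<integral>y\<in>p -` B \<inter> space M. u (p y) \<partial>M)"
      unfolding set_lebesgue_integral_def
      by (intro Bochner_Integration.integral_cong) (auto simp: indicator_def)
    finally show ?thesis by simp
  qed
  show ?thesis
  proof (rule V.real_cond_exp_charact)
    fix A assume "A \<in> sets (vimage_algebra (space M) p F)"
    then obtain B where B: "B \<in> sets F" "A = p -` B \<inter> space M"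
      by (auto simp: sets_vimage_algebra2[OF psp])
    moreover have "B \<in> sets N" using B F by (auto simp: subalgebra_def)
    ultimately show "(\<integral>y\<in>A. \<phi> (p y) \<partial>M) = (\<integral>y\<in>A. real_cond_exp N F \<phi> (p y) \<partial>M)"
      using \<phi> F.real_cond_exp_intA[OF \<phi> B(1)] by (simp add: set_int)
  next
    show "(\<lambda>y. real_cond_exp N F \<phi> (p y)) \<in> borel_measurable (vimage_algebra (space M) p F)"
      by (rule measurable_compose[OF measurable_vimage_algebra1[OF psp]]) simp
  qed (auto intro!: pull \<phi>)
qed

section \<open>Factor maps and changes of action\<close>

lemma factor_map_comp:
  assumes q: "factor_map Z Y q" and p: "factor_map Y X p"
  shows "factor_map Z X (p \<circ> q)"
  unfolding factor_map_def
proof (intro conjI allI)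
  have m: "q \<in> fst Z \<rightarrow>\<^sub>M fst Y" "p \<in> fst Y \<rightarrow>\<^sub>M fst X"
    and d: "distr (fst Z) (fst Y) q = fst Y" "distr (fst Y) (fst X) p = fst X"
    using assms by (auto simp: factor_map_def)
  show "p \<circ> q \<in> fst Z \<rightarrow>\<^sub>M fst X"
    by (rule measurable_comp[OF m])
  show "distr (fst Z) (fst X) (p \<circ> q) = fst X"
    using distr_distr[OF m(2,1)] d by simp
  fix g
  \<comment> \<open>The equivariance of \<open>p\<close> can fail only on a null set of
    \<open>Y\<close>, whose preimage under the measure-preserving \<open>q\<close> is null
    again.\<close>
  have "AE y in distr (fst Z) (fst Y) q. p (snd Y g y) = snd X g (p y)"
    using p unfolding d(1) factor_map_def by blast
  then have "AE z in fst Z. p (snd Y g (q z)) = snd X g (p (q z))"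
    by (rule AE_distrD[OF m(1)])
  moreover have "AE z in fst Z. q (snd Z g z) = snd Y g (q z)"
    using q by (simp add: factor_map_def)
  ultimately show "AE z in fst Z. (p \<circ> q) (snd Z g z) = snd X g ((p \<circ> q) z)"
    by eventually_elim simp
qed

lemma zsystem_hom:
  assumes X: "zsystem X" and P: "\<And>g h. P (g + h) = P g + P h"
  shows "zsystem (fst X, \<lambda>g. snd X (P g))"
proof -
  have "P 0 = 0" using P[of 0 0] by simp
  then show ?thesis using X by (auto simp: zsystem_def P)
qed

lemma factor_map_hom:
  assumes "factor_map Y X p"
  shows "factor_map (fst Y, \<lambda>g. snd Y (P g)) (fst X, \<lambda>g. snd X (P g)) p"
  using assms unfolding factor_map_def fst_conv snd_conv by blast

text \<open>Split \<open>g\<close> as \<open>P g + (g - P g)\<close>: the second summand lies in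
  \<open>H\<close> and acts trivially almost everywhere. This keeps the modified joining an
  extension of \<open>X i\<close>.\<close>

lemma factor_map_hom_id:
  assumes X: "zsystem X" "in_Z0 H X" and P: "\<And>g. g - P g \<in> H"
  shows "factor_map (fst X, \<lambda>g. snd X (P g)) X (\<lambda>x. x)"
  unfolding factor_map_def
proof (intro conjI allI)
  fix g
  have "AE x in fst X. snd X (g - P g) x = x"
    using X(2) P by (auto simp: in_Z0_def)
  moreover have "AE x in fst X. snd X g x = snd X (P g) (snd X (g - P g) x)"
    using X(1) unfolding zsystem_def by (intro AE_I2) (metis add_diff_cancel_left' diff_add_cancel)
  ultimately show "AE x in fst (fst X, \<lambda>g. snd X (P g)).
      snd (fst X, \<lambda>g. snd X (P g)) g x = snd X g x"
    unfolding fst_conv snd_conv by eventually_elim simp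
qed (auto simp: distr_id2)

section \<open>Copies of systems on the real line\<close>

text \<open>Satedness and the classes speak of systems carried by \<open>real\<close>, so systems on
  other types enter through isomorphic copies. That \<open>h (k x) = x\<close> holds at every point
  of the space allows functions to be recovered exactly, not just almost everywhere.\<close>

lemma real_copy:
  fixes X :: "('a, 'd::finite) sys"
  assumes X: "zsystem X"
  obtains Z :: "(real, 'd) sys" and h k where "zsystem Z" "factor_map Z X h" "factor_map X Z k"
    "\<And>x. x \<in> space (fst X) \<Longrightarrow> h (k x) = x" "\<And>L. in_Z0 L X \<Longrightarrow> in_Z0 L Z"
proof -
  define M where "M = fst X"
  define T where "T = snd X"
  interpret prob_space M using X by (simp add: zsystem_def M_def)
  have T: "\<And>g. T g \<in> M \<rightarrow>\<^sub>M M" "\<And>g. distr M M (T g) = M" "\<And>x. x \<in> space M \<Longrightarrow> T 0 x = x"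
    "\<And>g h x. x \<in> space M \<Longrightarrow> T (g + h) x = T g (T h x)"
    using X by (auto simp: zsystem_def M_def T_def)
  obtain B k where B: "B \<in> sets (borel :: real measure)" and bij: "bij_betw k (space M) B"
    and k: "k \<in> M \<rightarrow>\<^sub>M restrict_space borel B"
    and h: "the_inv_into (space M) k \<in> restrict_space borel B \<rightarrow>\<^sub>M M"
    using X by (auto simp: zsystem_def standard_borel_def M_def)
  define h where "h = the_inv_into (space M) k"
  define N where "N = distr M (restrict_space borel B) k"
  have sN: "sets N = sets (restrict_space borel B)" and spN: "space N = B"
    by (simp_all add: N_def space_restrict_space)
  have kN [measurable]: "k \<in> M \<rightarrow>\<^sub>M N" and hN [measurable]: "h \<in> N \<rightarrow>\<^sub>M M"
    using k h by (simp_all add: h_def measurable_cong_sets[OF sN refl] measurable_cong_sets[OF refl sN])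
  have hk: "h (k x) = x" if "x \<in> space M" for x
    using bij that unfolding h_def bij_betw_def by (auto intro: the_inv_into_f_f)
  have kh: "k (h z) = z" if "z \<in> B" for z
    using bij that unfolding h_def bij_betw_def by (auto intro: f_the_inv_into_f)
  have dk: "distr M N k = N"
    unfolding N_def by (rule distr_cong) auto
  have dh: "distr N M h = M"
  proof -
    have "distr N M h = distr (distr M N k) M h" by (simp add: dk)
    also have "\<dots> = distr M M (\<lambda>x. x)"
      by (subst distr_distr) (simp_all add: hk cong: distr_cong)
    finally show ?thesis by (simp add: distr_id2)
  qed
  note [measurable] = T(1)
  \<comment> \<open>The action is conjugated by the Borel isomorphism \<open>k\<close> and its
    inverse \<open>h\<close>.\<close>
  define U where "U = (\<lambda>g z. k (T g (h z)))"
  have U [measurable]: "U g \<in> N \<rightarrow>\<^sub>M N" for g unfolding U_def by measurable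
  have dU: "distr N N (U g) = N" for g
  proof -
    have "distr N N (U g) = distr (distr (distr N M h) M (T g)) N k"
      by (simp add: distr_distr U_def comp_def)
    also have "\<dots> = N" by (simp add: dh T dk)
    finally show ?thesis .
  qed
  have hsp: "h z \<in> space M" if "z \<in> B" for z
    using measurable_space[OF hN] that by (simp add: spN)
  have Tsp: "T g x \<in> space M" if "x \<in> space M" for g x
    using measurable_space[OF T(1)] that by simp
  \<comment> \<open>The space of \<open>N\<close> is the Borel set \<open>B\<close> itself, so the
    identity serves as Borel isomorphism.\<close>
  have std: "standard_borel N"
    unfolding standard_borel_def
  proof (intro bexI[OF _ B] exI conjI)
    show "bij_betw (\<lambda>x. x) (space N) B" by (simp add: spN bij_betw_def inj_on_def)
    show "(\<lambda>x. x) \<in> N \<rightarrow>\<^sub>M restrict_space borel B"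
      by (simp add: measurable_cong_sets[OF sN refl])
    have "the_inv_into (space N) (\<lambda>x. x) z = z" if "z \<in> B" for z
      using that by (intro the_inv_into_f_eq) (auto simp: spN inj_on_def)
    then have "the_inv_into (space N) (\<lambda>x. x) \<in> restrict_space borel B \<rightarrow>\<^sub>M N
        \<longleftrightarrow> (\<lambda>x. x) \<in> restrict_space borel B \<rightarrow>\<^sub>M N"
      by (intro measurable_cong) (auto simp: space_restrict_space)
    then show "the_inv_into (space N) (\<lambda>x. x) \<in> restrict_space borel B \<rightarrow>\<^sub>M N"
      by (simp add: measurable_cong_sets[OF refl sN])
  qed
  show ?thesis
  proof (rule that[of "(N, U)" h k])
    show "zsystem (N, U)"
      unfolding zsystem_def
      using std prob_space_distr[OF k] U dU
      by (auto simp: N_def[symmetric] spN) (auto simp: U_def T hsp kh hk Tsp)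
    show "factor_map (N, U) X h"
      unfolding factor_map_def
      by (auto simp: M_def[symmetric] T_def[symmetric] dh spN U_def hk Tsp hsp intro!: AE_I2)
    show "factor_map X (N, U) k"
      unfolding factor_map_def
      by (auto simp: M_def[symmetric] T_def[symmetric] dk U_def hk intro!: AE_I2)
    show "h (k x) = x" if "x \<in> space (fst X)" for x
      using hk that by (simp add: M_def)
    show "in_Z0 L (N, U)" if L: "in_Z0 L X" for L
      unfolding in_Z0_def
    proof
      fix \<gamma> assume "\<gamma> \<in> L"
      then have "AE x in M. T \<gamma> x = x"
        using L unfolding in_Z0_def M_def T_def by blast
      then have "AE x in distr N M h. T \<gamma> x = x"
        by (simp only: dh)
      then have "AE z in N. T \<gamma> (h z) = h z"
        by (rule AE_distrD[OF hN])
      then show "AE x in fst (N, U). snd (N, U) \<gamma> x = x"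
        unfolding fst_conv snd_conv
        by (rule AE_mp) (auto intro!: AE_I2 simp: spN U_def kh)
    qed
  qed
qed

section \<open>The maximal factor for a join of classes\<close>

lemma sets_zeta:
  "sets (zeta C X) = sigma_sets (space (fst X))
     (\<Union>{ {p -` S \<inter> space (fst X) | S. S \<in> sets (fst Z)} | Z p.
           zsystem Z \<and> C Z \<and> factor_map X Z p })"
  unfolding zeta_def by (rule sets_measure_of) blast

lemma space_zeta [simp]: "space (zeta C X) = space (fst X)"
  unfolding zeta_def by (rule space_measure_of) blast

lemma subalgebra_zeta: "subalgebra (fst X) (zeta C X)"
proof -
  have "(\<Union>{ {p -` S \<inter> space (fst X) | S. S \<in> sets (fst Z)} | Z p.
           zsystem Z \<and> C Z \<and> factor_map X Z p }) \<subseteq> sets (fst X)"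
    unfolding factor_map_def using measurable_sets by blast
  then show ?thesis
    unfolding subalgebra_def sets_zeta by (simp add: sets.sigma_sets_subset)
qed

lemma measurable_zeta:
  assumes "zsystem Z" "C Z" and p: "factor_map X Z p"
  shows "p \<in> zeta C X \<rightarrow>\<^sub>M fst Z"
proof (rule measurableI)
  show "p x \<in> space (fst Z)" if "x \<in> space (zeta C X)" for x
    using p that measurable_space[of p "fst X" "fst Z" x] unfolding factor_map_def by simp
  fix S assume "S \<in> sets (fst Z)"
  then show "p -` S \<inter> space (zeta C X) \<in> sets (zeta C X)"
    unfolding sets_zeta space_zeta
    by (intro sigma_sets.Basic UnionI[of "{p -` S \<inter> space (fst X) | S. S \<in> sets (fst Z)}"])
      (use assms in blast)+
qed

text \<open>Membership in the join asks for a factor at every index of \<open>J\<close>. Trivial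
  systems fill the indices other than \<open>j\<close>, and \<open>Z\<close> at index
  \<open>j\<close> already generates everything.\<close>

lemma Z0_join_component:
  fixes Z :: "(real, 'd::finite) sys"
  assumes Z: "zsystem Z" "in_Z0 (L j) Z" and j: "j \<in> J"
  shows "Z0_join J L Z"
proof -
  \<comment> \<open>The trivial system is realized as the point mass at 0 on the whole line; its
    identity action puts it in every class \<open>in_Z0\<close>.\<close>
  define E :: "(real, 'd) sys" where "E = (return borel 0, \<lambda>g x. x)"
  interpret prob_space "fst Z" using Z by (simp add: zsystem_def)
  have std: "standard_borel (return borel (0::real))"
    unfolding standard_borel_def
  proof (intro bexI[of _ UNIV] exI conjI)
    have "the_inv_into (space (return borel (0::real))) (\<lambda>x. x) z = z" for z
      by (rule the_inv_into_f_eq) (auto simp: inj_on_def)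
    then have "the_inv_into (space (return borel (0::real))) (\<lambda>x. x) = (\<lambda>x. x)"
      by blast
    then show "the_inv_into (space (return borel (0::real))) (\<lambda>x. x)
        \<in> restrict_space borel UNIV \<rightarrow>\<^sub>M return borel 0"
      by simp
  qed (auto simp: bij_betw_def)
  have E: "zsystem E"
    using std by (auto simp: E_def zsystem_def prob_space_return distr_id2)
  have ZE: "factor_map Z E (\<lambda>_. 0)"
    by (auto simp: factor_map_def E_def distr_const intro!: return_cong)
  have ZZ: "factor_map Z Z (\<lambda>x. x)"
    by (simp add: factor_map_def distr_id2)
  define W where "W k = (if k = j then Z else E)" for k
  define p :: "nat \<Rightarrow> real \<Rightarrow> real" where "p k = (if k = j then (\<lambda>x. x) else (\<lambda>_. 0))" for k
  have gen: "A \<in> sigma_sets (space (fst Z)) (\<Union>i\<in>J. {p i -` S \<inter> space (fst Z) | S. S \<in> sets (fst (W i))})"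
    if "A \<in> sets (fst Z)" for A
  proof (intro sigma_sets.Basic UN_I[OF j] CollectI exI conjI)
    show "A = p j -` A \<inter> space (fst Z)"
      using sets.sets_into_space[OF that] by (auto simp: p_def)
  qed (use that in \<open>simp add: W_def\<close>)
  have "is_joining Z J W p"
    unfolding is_joining_def
  proof (intro conjI ballI)
    fix A assume "A \<in> sets (fst Z)"
    then show "\<exists>B\<in>sigma_sets (space (fst Z)) (\<Union>i\<in>J. {p i -` S \<inter> space (fst Z) | S. S \<in> sets (fst (W i))}).
        measure (fst Z) (A - B \<union> (B - A)) = 0"
      by (intro bexI[of _ A] gen) auto
  qed (use Z E ZE ZZ in \<open>auto simp: W_def p_def\<close>)
  moreover have "\<forall>k\<in>J. in_Z0 (L k) (W k)"
    using Z by (auto simp: W_def in_Z0_def E_def)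
  ultimately show ?thesis
    unfolding Z0_join_def by blast
qed

text \<open>Equivariance and the trivial action of \<open>L\<close> on \<open>W\<close> give
  \<open>p (snd X \<gamma> x) = p x\<close> almost everywhere, so a preimage under \<open>p\<close>
  is moved only by a null set.\<close>

lemma vimage_in_inv_sets:
  assumes X: "zsystem X" and W: "in_Z0 L W" and p: "factor_map X W p" and S: "S \<in> sets (fst W)"
  shows "p -` S \<inter> space (fst X) \<in> inv_sets X L"
proof -
  interpret prob_space "fst X" using X by (simp add: zsystem_def)
  have T: "snd X g \<in> fst X \<rightarrow>\<^sub>M fst X" for g using X by (simp add: zsystem_def)
  have pm: "p \<in> fst X \<rightarrow>\<^sub>M fst W" and d: "distr (fst X) (fst W) p = fst W"
    using p by (simp_all add: factor_map_def)
  let ?A = "p -` S \<inter> space (fst X)"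
  have A: "?A \<in> sets (fst X)" by (rule measurable_sets[OF pm S])
  have "measure (fst X) ((?A - (snd X \<gamma> -` ?A \<inter> space (fst X))) \<union> ((snd X \<gamma> -` ?A \<inter> space (fst X)) - ?A)) = 0"
    if "\<gamma> \<in> L" for \<gamma>
  proof (subst measure_sym_diff_eq_0_iff[OF A measurable_sets[OF T A]])
    have "AE w in distr (fst X) (fst W) p. snd W \<gamma> w = w"
      using W that unfolding d in_Z0_def by blast
    then have "AE x in fst X. snd W \<gamma> (p x) = p x"
      by (rule AE_distrD[OF pm])
    moreover have "AE x in fst X. p (snd X \<gamma> x) = snd W \<gamma> (p x)"
      using p unfolding factor_map_def by blast
    moreover have "AE x in fst X. x \<in> space (fst X) \<and> snd X \<gamma> x \<in> space (fst X)"
      using measurable_space[OF T] by (intro AE_I2) auto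
    ultimately show "AE x in fst X. (x \<in> ?A) = (x \<in> snd X \<gamma> -` ?A \<inter> space (fst X))"
      by eventually_elim auto
  qed
  then show ?thesis using A by (simp add: inv_sets_def)
qed

lemma space_inv_sigma [simp]:
  "space (sigma (space (fst X)) (\<Union>j\<in>J. inv_sets X (L j))) = space (fst X)"
  by (rule space_measure_of) (auto simp: inv_sets_def dest: sets.sets_into_space)

lemma sets_inv_sigma:
  "sets (sigma (space (fst X)) (\<Union>j\<in>J. inv_sets X (L j)))
     = sigma_sets (space (fst X)) (\<Union>j\<in>J. inv_sets X (L j))"
  by (rule sets_measure_of) (auto simp: inv_sets_def dest: sets.sets_into_space)

lemma subalgebra_inv_sigma:
  "subalgebra (fst X) (sigma (space (fst X)) (\<Union>j\<in>J. inv_sets X (L j)))"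
proof -
  have "(\<Union>j\<in>J. inv_sets X (L j)) \<subseteq> sets (fst X)"
    by (auto simp: inv_sets_def)
  then show ?thesis
    unfolding subalgebra_def sets_inv_sigma by (simp add: sets.sigma_sets_subset)
qed

text \<open>A member of the join is generated, up to null sets, by sets from its components, and
  these pull back to invariant sets of \<open>X\<close>. Agreeing almost everywhere with a set of
  \<open>?\<Xi>\<close> passes to complements and countable unions, hence from the generators to the
  whole sigma-algebra.\<close>

lemma zeta_Z0_join_mod_null:
  assumes X: "zsystem X" and A: "A \<in> sets (zeta (Z0_join J L) X)"
  shows "\<exists>B\<in>sets (sigma (space (fst X)) (\<Union>j\<in>J. inv_sets X (L j))).
           AE x in fst X. x \<in> A \<longleftrightarrow> x \<in> B" (is "\<exists>B\<in>sets ?\<Xi>. _")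
  using A unfolding sets_zeta
proof induction
  case (Basic A)
  then obtain Z p S where Z: "zsystem Z" "Z0_join J L Z" and p: "factor_map X Z p"
    and S: "S \<in> sets (fst Z)" and A: "A = p -` S \<inter> space (fst X)"
    by blast
  interpret Z: prob_space "fst Z" using Z by (simp add: zsystem_def)
  have pm: "p \<in> fst X \<rightarrow>\<^sub>M fst Z" and d: "distr (fst X) (fst Z) p = fst Z"
    using p by (simp_all add: factor_map_def)
  obtain W :: "nat \<Rightarrow> (real, 'b) sys" and q where W: "\<forall>j\<in>J. in_Z0 (L j) (W j)" and join: "is_joining Z J W q"
    using Z(2) unfolding Z0_join_def by blast
  let ?G = "\<Union>i\<in>J. {q i -` S \<inter> space (fst Z) | S. S \<in> sets (fst (W i))}"
  have q: "factor_map Z (W j) (q j)" if "j \<in> J" for j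
    using join that by (simp add: is_joining_def)
  have G: "?G \<subseteq> sets (fst Z)"
    using q unfolding factor_map_def using measurable_sets by blast
  \<comment> \<open>\<open>B\<close> lies in the sigma-algebra strictly generated by the component
    sets, so its preimage will lie in \<open>?\<Xi>\<close> exactly. Passing from \<open>S\<close>
    to \<open>B\<close> is where null sets come in.\<close>
  obtain B where B: "B \<in> sigma_sets (space (fst Z)) ?G" "measure (fst Z) ((S - B) \<union> (B - S)) = 0"
    using join S unfolding is_joining_def by blast
  have "B \<in> sets (fst Z)"
    using B(1) sets.sigma_sets_subset[OF G] by blast
  then have "AE z in distr (fst X) (fst Z) p. z \<in> S \<longleftrightarrow> z \<in> B"
    using B(2) Z.measure_sym_diff_eq_0_iff[OF S] unfolding d by blast
  then have "AE x in fst X. p x \<in> S \<longleftrightarrow> p x \<in> B"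
    by (rule AE_distrD[OF pm])
  then have "AE x in fst X. x \<in> A \<longleftrightarrow> x \<in> p -` B \<inter> space (fst X)"
    unfolding A by (rule AE_mp) (auto intro!: AE_I2)
  \<comment> \<open>It suffices to test generators, whose preimages under \<open>p\<close> are
    preimages of sets of some \<open>W j\<close> under the composed factor map
    \<open>q j \<circ> p\<close>.\<close>
  moreover have "p \<in> ?\<Xi> \<rightarrow>\<^sub>M sigma (space (fst Z)) ?G"
  proof (rule measurable_measure_of)
    show "?G \<subseteq> Pow (space (fst Z))" by blast
    show "p \<in> space ?\<Xi> \<rightarrow> space (fst Z)"
      using measurable_space[OF pm] by simp
    fix C assume "C \<in> ?G"
    then obtain j S' where j: "j \<in> J" and S': "S' \<in> sets (fst (W j))"
      and C: "C = q j -` S' \<inter> space (fst Z)" by blast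
    have "(q j \<circ> p) -` S' \<inter> space (fst X) \<in> inv_sets X (L j)"
      using vimage_in_inv_sets[OF X _ factor_map_comp[OF p q[OF j]] S'] W j by blast
    moreover have "(q j \<circ> p) -` S' \<inter> space (fst X) = p -` C \<inter> space ?\<Xi>"
      using measurable_space[OF pm] by (auto simp: C)
    ultimately show "p -` C \<inter> space ?\<Xi> \<in> sets ?\<Xi>"
      using j unfolding sets_inv_sigma by (auto intro!: sigma_sets.Basic)
  qed
  then have "p -` B \<inter> space (fst X) \<in> sets ?\<Xi>"
    using measurable_sets[of p ?\<Xi> "sigma (space (fst Z)) ?G" B] B(1)
    by (simp add: sets_measure_of G[THEN subset_trans, OF sets.space_closed])
  ultimately show ?case by blast
next
  case Empty
  show ?case by (rule bexI[of _ "{}"]) auto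
next
  case (Compl A)
  then obtain B where B: "B \<in> sets ?\<Xi>" "AE x in fst X. x \<in> A \<longleftrightarrow> x \<in> B" by blast
  have "AE x in fst X. x \<in> space (fst X) - A \<longleftrightarrow> x \<in> space ?\<Xi> - B"
    using B(2) by eventually_elim simp
  then show ?case using B(1) by blast
next
  case (Union A)
  have "\<forall>n. \<exists>B. B \<in> sets ?\<Xi> \<and> (AE x in fst X. x \<in> A n \<longleftrightarrow> x \<in> B)"
    using Union.IH by blast
  from choice[OF this] obtain B where
    B: "\<And>n. B n \<in> sets ?\<Xi>" "\<And>n. AE x in fst X. x \<in> A n \<longleftrightarrow> x \<in> B n" by blast
  have "AE x in fst X. \<forall>n. x \<in> A n \<longleftrightarrow> x \<in> B n"
    using B(2) by (simp add: AE_all_countable)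
  then have "AE x in fst X. x \<in> (\<Union>n. A n) \<longleftrightarrow> x \<in> (\<Union>n. B n)"
    by eventually_elim auto
  moreover have "(\<Union>n. B n) \<in> sets ?\<Xi>" using B(1) by blast
  ultimately show ?case by blast
qed

section \<open>Exchanging one function under the integral\<close>

lemma prod_bounded_on:
  fixes f :: "'i \<Rightarrow> 'x \<Rightarrow> real"
  assumes "\<And>j. j \<in> J \<Longrightarrow> \<exists>B. \<forall>x\<in>S. \<bar>f j x\<bar> \<le> B"
  shows "\<exists>B. \<forall>x\<in>S. \<bar>\<Prod>j\<in>J. f j x\<bar> \<le> B"
proof -
  obtain B where B: "\<And>j x. j \<in> J \<Longrightarrow> x \<in> S \<Longrightarrow> \<bar>f j x\<bar> \<le> B j"
    using assms by metis
  have "\<bar>\<Prod>j\<in>J. f j x\<bar> \<le> (\<Prod>j\<in>J. B j)" if "x \<in> S" for x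
    unfolding abs_prod using B that by (intro prod_mono) auto
  then show ?thesis by blast
qed

lemma (in prob_space) integrable_bounded_on:
  fixes f :: "'a \<Rightarrow> real"
  assumes "f \<in> borel_measurable M" and "\<exists>B. \<forall>x\<in>space M. \<bar>f x\<bar> \<le> B"
  shows "integrable M f"
proof -
  obtain B where "\<forall>x\<in>space M. \<bar>f x\<bar> \<le> B" using assms(2) by blast
  then show ?thesis
    using assms(1) by (intro integrable_const_bound[of _ B]) auto
qed

text \<open>The product of the other functions, lifted to an extension \<open>V\<close> of
  \<open>X i\<close>, is measurable for the maximal factor of \<open>V\<close> in the class.
  Integration against it therefore sees only the conditional expectation of the lifted
  \<open>\<phi>\<close> on that factor, which satedness identifies with the one computed on
  \<open>X i\<close>.\<close>

lemma sated_joining_zeta: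
  fixes \<phi> :: "'a \<Rightarrow> real" and u :: "nat \<Rightarrow> 'a \<Rightarrow> real"
    and X :: "nat \<Rightarrow> ('a, 'd::finite) sys" and Y :: "('b, 'd) sys"
  assumes dec: "direct_sum_decomp r \<Gamma> \<Lambda>"
    and X: "\<forall>i<r. zsystem (X i) \<and> in_Z0 (\<Gamma> i) (X i) \<and> sated (C_class r \<Gamma> i) (X i)"
    and join: "is_joining Y {..<r} X \<pi>" and i: "i < r"
    and u: "\<And>j. j \<in> {..<r} - {i} \<Longrightarrow> u j \<in> borel_measurable (fst (X j))"
      "\<And>j. j \<in> {..<r} - {i} \<Longrightarrow> \<exists>B. \<forall>x\<in>space (fst (X j)). \<bar>u j x\<bar> \<le> B"
    and \<phi>: "\<phi> \<in> borel_measurable (fst (X i))" "\<exists>B. \<forall>x\<in>space (fst (X i)). \<bar>\<phi> x\<bar> \<le> B"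
  shows "(\<integral>y. (\<Prod>j\<in>{..<r} - {i}. u j (\<pi> j y)) * \<phi> (\<pi> i y) \<partial>fst Y)
    = (\<integral>y. (\<Prod>j\<in>{..<r} - {i}. u j (\<pi> j y))
         * real_cond_exp (fst (X i)) (zeta (C_class r \<Gamma> i) (X i)) \<phi> (\<pi> i y) \<partial>fst Y)"
proof -
  let ?J = "{..<r} - {i}" and ?C = "C_class r \<Gamma> i"
  have Y: "zsystem Y" and \<pi>: "\<And>j. j < r \<Longrightarrow> factor_map Y (X j) (\<pi> j)"
    using join by (auto simp: is_joining_def)
  obtain P where P: "\<And>g h. P (g + h) = P g + P h" "\<And>g. g - P g \<in> \<Gamma> i"
    "\<And>j a b. j < r \<Longrightarrow> j \<noteq> i \<Longrightarrow> a \<in> \<Gamma> i \<Longrightarrow> b \<in> \<Gamma> j \<Longrightarrow> P (a + b) = b"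
    using direct_sum_decomp_projection[OF dec i] by blast
  define X' where "X' j = (fst (X j), \<lambda>g. snd (X j) (P g))" for j
  define Y' where "Y' = (fst Y, \<lambda>g. snd Y (P g))"
  have \<pi>': "factor_map Y' (X' j) (\<pi> j)" if "j < r" for j
    unfolding X'_def Y'_def by (rule factor_map_hom[OF \<pi>[OF that]])
  \<comment> \<open>\<open>V\<close> carries the modified joining over to \<open>real\<close>, the
    type of the extensions over which satedness quantifies.\<close>
  obtain V :: "(real, 'd) sys" and h where V: "zsystem V" and h: "factor_map V Y' h"
    using real_copy[of Y'] zsystem_hom[OF Y, of P] P(1) unfolding Y'_def by metis
  have "factor_map (X' i) (X i) (\<lambda>x. x)"
    unfolding X'_def using X i P(2) by (intro factor_map_hom_id) auto
  then have p: "factor_map V (X i) (\<lambda>v. \<pi> i (h v))"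
    using factor_map_comp[OF factor_map_comp[OF h \<pi>'[OF i]]] by (simp add: comp_def)
  have meas: "(\<lambda>v. u j (\<pi> j (h v))) \<in> borel_measurable (zeta ?C V)" if j: "j \<in> ?J" for j
  proof -
    have j': "j < r" "j \<noteq> i" using j by auto
    \<comment> \<open>\<open>P\<close> sends \<open>a + b\<close> to \<open>b\<close>, so
      \<open>a + b\<close> acts on \<open>X' j\<close> as \<open>b\<close> acts on
      \<open>X j\<close>: trivially almost everywhere.\<close>
    have "in_Z0 (gsum (\<Gamma> i) (\<Gamma> j)) (X' j)"
      unfolding in_Z0_def gsum_def X'_def fst_conv snd_conv
    proof (safe)
      fix a b assume "a \<in> \<Gamma> i" "b \<in> \<Gamma> j"
      then show "AE x in fst (X j). snd (X j) (P (a + b)) x = x"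
        using X j'(1) unfolding P(3)[OF j' \<open>a \<in> \<Gamma> i\<close> \<open>b \<in> \<Gamma> j\<close>] in_Z0_def by blast
    qed
    moreover have "zsystem (X' j)"
      unfolding X'_def using X j' by (intro zsystem_hom P(1)) auto
    \<comment> \<open>The class contains systems on \<open>real\<close>, hence the copy
      \<open>Z\<close> of \<open>X' j\<close>. The function \<open>u j\<close> is measured on
      \<open>Z\<close> as \<open>u j (h' z)\<close> and regained through
      \<open>h' (k' x) = x\<close>.\<close>
    ultimately obtain Z :: "(real, 'd) sys" and h' k' where Z: "zsystem Z" "in_Z0 (gsum (\<Gamma> i) (\<Gamma> j)) Z"
      and h': "factor_map Z (X' j) h'" and k': "factor_map (X' j) Z k'"
      and hk: "\<And>x. x \<in> space (fst (X' j)) \<Longrightarrow> h' (k' x) = x"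
      using real_copy[of "X' j"] by metis
    have \<pi>h: "factor_map V (X' j) (\<pi> j \<circ> h)"
      by (rule factor_map_comp[OF h \<pi>'[OF j'(1)]])
    have "?C Z"
      unfolding C_class_def using Z j by (intro Z0_join_component[where j = j]) auto
    then have km: "k' \<circ> (\<pi> j \<circ> h) \<in> zeta ?C V \<rightarrow>\<^sub>M fst Z"
      using Z factor_map_comp[OF \<pi>h k'] by (intro measurable_zeta)
    have um: "(\<lambda>z. u j (h' z)) \<in> borel_measurable (fst Z)"
      using h' u(1)[OF j] by (auto simp: factor_map_def X'_def intro: measurable_compose)
    have "(\<lambda>v. u j (h' (k' (\<pi> j (h v))))) \<in> borel_measurable (zeta ?C V)"
      using measurable_compose[OF km um] by (simp add: comp_def)
    moreover have "\<pi> j (h v) \<in> space (fst (X' j))" if "v \<in> space (fst V)" for v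
      using \<pi>h that measurable_space[of "\<pi> j \<circ> h" "fst V" "fst (X' j)" v] by (simp add: factor_map_def)
    ultimately show ?thesis
      by (subst measurable_cong[of _ _ "\<lambda>v. u j (h' (k' (\<pi> j (h v))))"]) (auto simp: hk)
  qed
  interpret prob_space "fst V" using V by (simp add: zsystem_def)
  interpret finite_measure_subalgebra "fst V" "zeta ?C V"
    by unfold_locales (rule subalgebra_zeta)
  define w where "w y = (\<Prod>j\<in>?J. u j (\<pi> j y))" for y
  have hm: "h \<in> fst V \<rightarrow>\<^sub>M fst Y" and hd: "distr (fst V) (fst Y) h = fst Y"
    using h by (auto simp: factor_map_def Y'_def)
  have \<pi>m: "\<pi> j \<in> fst Y \<rightarrow>\<^sub>M fst (X j)" if "j < r" for j
    using \<pi>[OF that] by (simp add: factor_map_def)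
  have wm: "w \<in> borel_measurable (fst Y)"
    unfolding w_def by (intro borel_measurable_prod measurable_compose[OF \<pi>m u(1)]) auto
  \<comment> \<open>Modifying the action has left the measure of \<open>Y\<close> alone, and
    \<open>h\<close> carries the measure of \<open>V\<close> to it, so integrals over
    \<open>Y\<close> can be computed on \<open>V\<close>.\<close>
  have transfer: "(\<integral>y. w y * f (\<pi> i y) \<partial>fst Y) = (\<integral>v. w (h v) * f (\<pi> i (h v)) \<partial>fst V)"
    if "f \<in> borel_measurable (fst (X i))" for f
  proof -
    have "(\<lambda>y. w y * f (\<pi> i y)) \<in> borel_measurable (fst Y)"
      using wm measurable_compose[OF \<pi>m[OF i] that] by measurable
    then show ?thesis
      using integral_distr[OF hm, of "\<lambda>y. w y * f (\<pi> i y)"] by (simp add: hd)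
  qed
  have \<phi>V: "(\<lambda>v. \<phi> (\<pi> i (h v))) \<in> borel_measurable (fst V)"
    using measurable_compose[OF hm measurable_compose[OF \<pi>m[OF i] \<phi>(1)]] .
  have wV: "(\<lambda>v. w (h v)) \<in> borel_measurable (zeta ?C V)"
    unfolding w_def by (intro borel_measurable_prod meas)
  have sp: "\<pi> j (h v) \<in> space (fst (X j))" if "j < r" "v \<in> space (fst V)" for j v
    using measurable_space[OF \<pi>m[OF that(1)] measurable_space[OF hm that(2)]] .
  have wb: "\<exists>B. \<forall>v\<in>space (fst V). \<bar>w (h v)\<bar> \<le> B"
    unfolding w_def
  proof (rule prod_bounded_on)
    fix j assume "j \<in> ?J"
    then show "\<exists>B. \<forall>v\<in>space (fst V). \<bar>u j (\<pi> j (h v))\<bar> \<le> B"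
      using u(2)[of j] sp[of j] by (auto; blast)
  qed
  have int: "integrable (fst V) (\<lambda>v. w (h v) * \<phi> (\<pi> i (h v)))"
  proof (rule integrable_bounded_on)
    show "(\<lambda>v. w (h v) * \<phi> (\<pi> i (h v))) \<in> borel_measurable (fst V)"
      using measurable_from_subalg[OF subalg wV] \<phi>V by measurable
    obtain B1 where B1: "\<forall>v\<in>space (fst V). \<bar>w (h v)\<bar> \<le> B1" using wb by blast
    obtain B2 where B2: "\<forall>x\<in>space (fst (X i)). \<bar>\<phi> x\<bar> \<le> B2" using \<phi>(2) by blast
    have "\<bar>w (h v) * \<phi> (\<pi> i (h v))\<bar> \<le> B1 * B2" if "v \<in> space (fst V)" for v
      using B1 B2 sp[OF i that] that unfolding abs_mult
      by (intro mult_mono) (auto intro: order_trans[OF abs_ge_zero])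
    then show "\<exists>B. \<forall>v\<in>space (fst V). \<bar>w (h v) * \<phi> (\<pi> i (h v))\<bar> \<le> B" by blast
  qed
  \<comment> \<open>This is satedness of \<open>X i\<close> for the extension \<open>V\<close>,
    which carries the modified action.\<close>
  have sat: "AE v in fst V. real_cond_exp (fst V) (zeta ?C V) (\<lambda>v. \<phi> (\<pi> i (h v))) v
      = real_cond_exp (fst (X i)) (zeta ?C (X i)) \<phi> (\<pi> i (h v))"
    using X i V p \<phi> unfolding sated_def comp_def by blast
  have Em: "real_cond_exp (fst (X i)) (zeta ?C (X i)) \<phi> \<in> borel_measurable (fst (X i))"
    by simp
  have "(\<integral>y. w y * \<phi> (\<pi> i y) \<partial>fst Y) = (\<integral>v. w (h v) * \<phi> (\<pi> i (h v)) \<partial>fst V)"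
    by (rule transfer[OF \<phi>(1)])
  also have "\<dots> = (\<integral>v. w (h v) * real_cond_exp (fst V) (zeta ?C V) (\<lambda>v. \<phi> (\<pi> i (h v))) v \<partial>fst V)"
    by (rule real_cond_exp_intg(2)[OF int wV \<phi>V, symmetric])
  also have "\<dots> = (\<integral>v. w (h v) * real_cond_exp (fst (X i)) (zeta ?C (X i)) \<phi> (\<pi> i (h v)) \<partial>fst V)"
  proof (rule integral_cong_AE)
    note [measurable] = measurable_from_subalg[OF subalg wV]
    show "(\<lambda>v. w (h v) * real_cond_exp (fst V) (zeta ?C V) (\<lambda>v. \<phi> (\<pi> i (h v))) v) \<in> borel_measurable (fst V)"
      by measurable
    show "(\<lambda>v. w (h v) * real_cond_exp (fst (X i)) (zeta ?C (X i)) \<phi> (\<pi> i (h v))) \<in> borel_measurable (fst V)"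
      using measurable_compose[OF hm measurable_compose[OF \<pi>m[OF i] Em]] by measurable
    show "AE v in fst V. w (h v) * real_cond_exp (fst V) (zeta ?C V) (\<lambda>v. \<phi> (\<pi> i (h v))) v
        = w (h v) * real_cond_exp (fst (X i)) (zeta ?C (X i)) \<phi> (\<pi> i (h v))"
      using sat by eventually_elim simp
  qed
  also have "\<dots> = (\<integral>y. w y * real_cond_exp (fst (X i)) (zeta ?C (X i)) \<phi> (\<pi> i y) \<partial>fst Y)"
    by (rule transfer[OF Em, symmetric])
  finally show ?thesis by (simp add: w_def)
qed

text \<open>Both integrals equal the one containing the common conditional expectation of
  \<open>\<phi>\<close> and \<open>\<psi>\<close> on the maximal factor. Allowing any bounded
  version \<open>\<psi>\<close> makes the exchange repeatable, since the new family is again bounded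
  everywhere.\<close>

lemma sated_joining_step:
  fixes \<phi> \<psi> :: "'a \<Rightarrow> real" and u :: "nat \<Rightarrow> 'a \<Rightarrow> real"
    and X :: "nat \<Rightarrow> ('a, 'd::finite) sys" and Y :: "('b, 'd) sys"
  assumes dec: "direct_sum_decomp r \<Gamma> \<Lambda>"
    and X: "\<forall>i<r. zsystem (X i) \<and> in_Z0 (\<Gamma> i) (X i) \<and> sated (C_class r \<Gamma> i) (X i)"
    and join: "is_joining Y {..<r} X \<pi>" and i: "i < r"
    and u: "\<And>j. j \<in> {..<r} - {i} \<Longrightarrow> u j \<in> borel_measurable (fst (X j))"
      "\<And>j. j \<in> {..<r} - {i} \<Longrightarrow> \<exists>B. \<forall>x\<in>space (fst (X j)). \<bar>u j x\<bar> \<le> B"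
    and \<phi>: "\<phi> \<in> borel_measurable (fst (X i))" "\<exists>B. \<forall>x\<in>space (fst (X i)). \<bar>\<phi> x\<bar> \<le> B"
    and \<psi>: "\<psi> \<in> borel_measurable (fst (X i))" "\<exists>B. \<forall>x\<in>space (fst (X i)). \<bar>\<psi> x\<bar> \<le> B"
    and \<psi>\<phi>: "AE x in fst (X i). \<psi> x = real_cond_exp (fst (X i)) (sigma (space (fst (X i)))
                     (\<Union>j\<in>{..<r} - {i}. inv_sets (X i) (gsum (\<Gamma> i) (\<Gamma> j)))) \<phi> x"
  shows "(\<integral>y. (\<Prod>j\<in>{..<r} - {i}. u j (\<pi> j y)) * \<phi> (\<pi> i y) \<partial>fst Y)
    = (\<integral>y. (\<Prod>j\<in>{..<r} - {i}. u j (\<pi> j y)) * \<psi> (\<pi> i y) \<partial>fst Y)"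
proof -
  let ?E = "real_cond_exp (fst (X i)) (zeta (C_class r \<Gamma> i) (X i))"
  have Xi: "zsystem (X i)" using X i by blast
  interpret prob_space "fst (X i)" using Xi by (simp add: zsystem_def)
  \<comment> \<open>Tower property: modulo null sets, the maximal factor lies in the sigma-algebra
    generated by the invariant sets.\<close>
  have "AE x in fst (X i). ?E \<phi> x = ?E \<psi> x"
    using zeta_Z0_join_mod_null[OF Xi] \<psi>\<phi> \<phi> \<psi> unfolding C_class_def
    by (intro real_cond_exp_coarser_mod_null[OF _ subalgebra_zeta subalgebra_inv_sigma])
      (auto intro: integrable_bounded_on finite_measure_axioms)
  moreover have \<pi>m: "\<pi> j \<in> fst Y \<rightarrow>\<^sub>M fst (X j)" "distr (fst Y) (fst (X j)) (\<pi> j) = fst (X j)"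
    if "j < r" for j
    using join that by (auto simp: is_joining_def factor_map_def)
  ultimately have E: "AE y in fst Y. ?E \<phi> (\<pi> i y) = ?E \<psi> (\<pi> i y)"
    using i by (intro AE_distrD[OF \<pi>m(1)]) (simp_all only: \<pi>m(2))
  have [measurable]: "(\<lambda>y. \<Prod>j\<in>{..<r} - {i}. u j (\<pi> j y)) \<in> borel_measurable (fst Y)"
    by (intro borel_measurable_prod measurable_compose[OF \<pi>m(1) u(1)]) auto
  note [measurable] = \<pi>m(1)[OF i]
  have "(\<integral>y. (\<Prod>j\<in>{..<r} - {i}. u j (\<pi> j y)) * ?E \<phi> (\<pi> i y) \<partial>fst Y)
    = (\<integral>y. (\<Prod>j\<in>{..<r} - {i}. u j (\<pi> j y)) * ?E \<psi> (\<pi> i y) \<partial>fst Y)"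
  proof (rule integral_cong_AE)
    show "AE y in fst Y. (\<Prod>j\<in>{..<r} - {i}. u j (\<pi> j y)) * ?E \<phi> (\<pi> i y)
        = (\<Prod>j\<in>{..<r} - {i}. u j (\<pi> j y)) * ?E \<psi> (\<pi> i y)"
      using E by eventually_elim simp
  qed measurable
  then show ?thesis
    using sated_joining_zeta[OF dec X join i u \<phi>] sated_joining_zeta[OF dec X join i u \<psi>] by simp
qed

section \<open>Exchanging all functions in turn\<close>

theorem theorem4:
  fixes \<Gamma> :: "nat \<Rightarrow> (int ^ 'd::finite) set" and \<Lambda> :: "(int ^ 'd) set" and r :: nat
    and X :: "nat \<Rightarrow> ('a, 'd) sys" and Y :: "('b, 'd) sys" and \<pi> :: "nat \<Rightarrow> 'b \<Rightarrow> 'a"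
  assumes "direct_sum_decomp r \<Gamma> \<Lambda>"
    and "\<forall>i<r. zsystem (X i) \<and> in_Z0 (\<Gamma> i) (X i) \<and> sated (C_class r \<Gamma> i) (X i)"
    and "is_joining Y {..<r} X \<pi>"
  shows "rel_indep (fst Y) {..<r}
           (\<lambda>i. vimage_algebra (space (fst Y)) (\<pi> i) (fst (X i)))
           (\<lambda>i. vimage_algebra (space (fst Y)) (\<pi> i)
                  (sigma (space (fst (X i)))
                     (\<Union>j\<in>{..<r} - {i}. inv_sets (X i) (gsum (\<Gamma> i) (\<Gamma> j)))))"
proof -
  let ?\<Xi> = "\<lambda>i. sigma (space (fst (X i))) (\<Union>j\<in>{..<r} - {i}. inv_sets (X i) (gsum (\<Gamma> i) (\<Gamma> j)))"
  let ?V = "\<lambda>i. vimage_algebra (space (fst Y)) (\<pi> i)"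
  \<comment> \<open>The bounded functions on \<open>X i\<close> that stand for data on the joining:
    \<open>\<phi>\<close> for \<open>f\<close>, and \<open>\<psi>\<close> for the conditional
    expectation of \<open>f\<close>.\<close>
  let ?good = "\<lambda>i f \<phi> \<psi>. \<phi> \<in> borel_measurable (fst (X i)) \<and> (\<exists>B. \<forall>x\<in>space (fst (X i)). \<bar>\<phi> x\<bar> \<le> B)
      \<and> \<psi> \<in> borel_measurable (fst (X i)) \<and> (\<exists>B. \<forall>x\<in>space (fst (X i)). \<bar>\<psi> x\<bar> \<le> B)
      \<and> (AE x in fst (X i). \<psi> x = real_cond_exp (fst (X i)) (?\<Xi> i) \<phi> x)
      \<and> (\<forall>y\<in>space (fst Y). f y = \<phi> (\<pi> i y))
      \<and> (AE y in fst Y. real_cond_exp (fst Y) (?V i (?\<Xi> i)) f y = \<psi> (\<pi> i y))"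
  have Xi: "prob_space (fst (X i))" if "i < r" for i
    using assms(2) that by (simp add: zsystem_def)
  interpret Y: prob_space "fst Y" using assms(3) by (simp add: is_joining_def zsystem_def)
  have \<pi>m: "\<pi> i \<in> fst Y \<rightarrow>\<^sub>M fst (X i)" and \<pi>d: "distr (fst Y) (fst (X i)) (\<pi> i) = fst (X i)"
    if "i < r" for i
    using assms(3) that by (auto simp: is_joining_def factor_map_def)
  have choose: "\<exists>\<phi> \<psi>. ?good i f \<phi> \<psi>"
    if i: "i < r" and f: "f \<in> borel_measurable (?V i (fst (X i)))"
      and bd: "\<exists>B. \<forall>x\<in>space (fst Y). \<bar>f x\<bar> \<le> B" for i and f :: "'b \<Rightarrow> real"
  proof -
    interpret prob_space "fst (X i)" by (rule Xi[OF i])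
    interpret finite_measure_subalgebra "fst (X i)" "?\<Xi> i"
      by unfold_locales (rule subalgebra_inv_sigma)
    obtain B where B: "\<And>y. y \<in> space (fst Y) \<Longrightarrow> \<bar>f y\<bar> \<le> B" using bd by blast
    \<comment> \<open>A probability space has a point, which forces \<open>B\<close> to be
      nonnegative; only then is truncation to the interval from \<open>- B\<close> to
      \<open>B\<close> bounded by \<open>B\<close>.\<close>
    have B0: "0 \<le> B"
      using B Y.not_empty by (meson abs_ge_zero order_trans ex_in_conv)
    have "\<pi> i \<in> space (fst Y) \<rightarrow> space (fst (X i))"
      using measurable_space[OF \<pi>m[OF i]] by blast
    from borel_measurable_vimage_algebra_factor[OF f this]
    obtain \<phi>0 where \<phi>0 [measurable]: "\<phi>0 \<in> borel_measurable (fst (X i))"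
      and f_eq: "\<And>y. y \<in> space (fst Y) \<Longrightarrow> f y = \<phi>0 (\<pi> i y)" by blast
    \<comment> \<open>The bound on \<open>\<phi>0\<close> is known only on the image of
      \<open>\<pi> i\<close>, and that on the conditional expectation only almost everywhere.
      Truncation makes both hold everywhere, without changing values where the bound already
      holds.\<close>
    define clip where "clip t = max (- B) (min B t)" for t
    have clip: "\<bar>clip t\<bar> \<le> B" and clip_id: "\<bar>t\<bar> \<le> B \<Longrightarrow> clip t = t" for t
      using B0 by (auto simp: clip_def)
    have [measurable]: "clip \<in> borel_measurable borel"
      unfolding clip_def by measurable
    define \<phi> where "\<phi> x = clip (\<phi>0 x)" for x
    define \<psi> where "\<psi> x = clip (real_cond_exp (fst (X i)) (?\<Xi> i) \<phi> x)" for x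
    have \<phi>m: "\<phi> \<in> borel_measurable (fst (X i))" unfolding \<phi>_def by measurable
    have \<psi>m: "\<psi> \<in> borel_measurable (fst (X i))" unfolding \<psi>_def by measurable
    have \<phi>i: "integrable (fst (X i)) \<phi>"
      using \<phi>m clip by (intro integrable_bounded_on) (auto simp: \<phi>_def)
    have "\<phi> x \<le> B" "- B \<le> \<phi> x" for x
      using clip[of "\<phi>0 x"] by (simp_all add: \<phi>_def)
    then have "AE x in fst (X i). real_cond_exp (fst (X i)) (?\<Xi> i) \<phi> x \<le> B"
      "AE x in fst (X i). real_cond_exp (fst (X i)) (?\<Xi> i) \<phi> x \<ge> - B"
      by (intro real_cond_exp_le_c[OF \<phi>i] real_cond_exp_ge_c[OF \<phi>i] AE_I2; simp)+
    then have \<psi>\<phi>: "AE x in fst (X i). \<psi> x = real_cond_exp (fst (X i)) (?\<Xi> i) \<phi> x"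
      by eventually_elim (simp add: \<psi>_def clip_id abs_le_iff minus_le_iff)
    have f\<phi>: "f y = \<phi> (\<pi> i y)" if "y \<in> space (fst Y)" for y
      using B[OF that] f_eq[OF that] by (simp add: \<phi>_def clip_id)
    have \<psi>\<pi>: "AE y in fst Y. \<psi> (\<pi> i y) = real_cond_exp (fst (X i)) (?\<Xi> i) \<phi> (\<pi> i y)"
      using \<psi>\<phi> by (intro AE_distrD[OF \<pi>m[OF i]]) (simp only: \<pi>d[OF i])
    have \<phi>\<pi>m: "(\<lambda>y. \<phi> (\<pi> i y)) \<in> borel_measurable (fst Y)"
      by (rule measurable_compose[OF \<pi>m[OF i] \<phi>m])
    have fm: "f \<in> borel_measurable (fst Y)"
      using \<phi>\<pi>m f\<phi> by (subst measurable_cong[of _ _ "\<lambda>y. \<phi> (\<pi> i y)"]) auto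
    have piXi: "\<pi> i \<in> fst Y \<rightarrow>\<^sub>M ?\<Xi> i"
      using measurable_from_subalg \<pi>m[OF i] subalg unfolding subalgebra_def
      by (auto simp: measurable_def)
    have "subalgebra (fst Y) (?V i (?\<Xi> i))"
      using sets_image_in_sets[OF refl piXi] by (simp add: subalgebra_def)
    then interpret V: finite_measure_subalgebra "fst Y" "?V i (?\<Xi> i)"
      by unfold_locales
    have "AE y in fst Y. real_cond_exp (fst Y) (?V i (?\<Xi> i)) f y
        = real_cond_exp (fst Y) (?V i (?\<Xi> i)) (\<lambda>y. \<phi> (\<pi> i y)) y"
      using f\<phi> by (intro V.real_cond_exp_cong fm \<phi>\<pi>m AE_I2)
    \<comment> \<open>The conditional expectation on the joining is the lift of the one on
      \<open>X i\<close>.\<close>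
    moreover have "AE y in fst Y. real_cond_exp (fst Y) (?V i (?\<Xi> i)) (\<lambda>y. \<phi> (\<pi> i y)) y
        = real_cond_exp (fst (X i)) (?\<Xi> i) \<phi> (\<pi> i y)"
      by (rule real_cond_exp_vimage_algebra[OF Y.prob_space_axioms \<pi>m[OF i] \<pi>d[OF i] subalg \<phi>i])
    ultimately have "AE y in fst Y. real_cond_exp (fst Y) (?V i (?\<Xi> i)) f y = \<psi> (\<pi> i y)"
      using \<psi>\<pi> by eventually_elim simp
    moreover have "\<exists>B. \<forall>x\<in>space (fst (X i)). \<bar>\<phi> x\<bar> \<le> B" "\<exists>B. \<forall>x\<in>space (fst (X i)). \<bar>\<psi> x\<bar> \<le> B"
      using clip unfolding \<phi>_def \<psi>_def by blast+
    ultimately show ?thesis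
      using \<phi>m \<psi>m \<psi>\<phi> f\<phi> by blast
  qed
  show ?thesis
    unfolding rel_indep_def
  proof (intro allI impI)
    fix f :: "nat \<Rightarrow> 'b \<Rightarrow> real"
    assume f: "\<forall>i\<in>{..<r}. f i \<in> borel_measurable (?V i (fst (X i))) \<and> (\<exists>B. \<forall>x\<in>space (fst Y). \<bar>f i x\<bar> \<le> B)"
    have "\<forall>i\<in>{..<r}. \<exists>\<phi> \<psi>. ?good i (f i) \<phi> \<psi>"
      using f choose by blast
    from bchoice[OF this] obtain \<phi> where "\<forall>i\<in>{..<r}. \<exists>\<psi>. ?good i (f i) (\<phi> i) \<psi>" ..
    from bchoice[OF this] obtain \<psi> where "\<forall>i\<in>{..<r}. ?good i (f i) (\<phi> i) (\<psi> i)" ..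
    then have
      \<phi>: "\<And>i. i < r \<Longrightarrow> \<phi> i \<in> borel_measurable (fst (X i))"
        "\<And>i. i < r \<Longrightarrow> \<exists>B. \<forall>x\<in>space (fst (X i)). \<bar>\<phi> i x\<bar> \<le> B"
      and \<psi>: "\<And>i. i < r \<Longrightarrow> \<psi> i \<in> borel_measurable (fst (X i))"
        "\<And>i. i < r \<Longrightarrow> \<exists>B. \<forall>x\<in>space (fst (X i)). \<bar>\<psi> i x\<bar> \<le> B"
      and \<psi>\<phi>: "\<And>i. i < r \<Longrightarrow> AE x in fst (X i). \<psi> i x = real_cond_exp (fst (X i)) (?\<Xi> i) (\<phi> i) x"
      and f\<phi>: "\<And>i y. i < r \<Longrightarrow> y \<in> space (fst Y) \<Longrightarrow> f i y = \<phi> i (\<pi> i y)"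
      and f\<psi>: "\<And>i. i < r \<Longrightarrow> AE y in fst Y. real_cond_exp (fst Y) (?V i (?\<Xi> i)) (f i) y = \<psi> i (\<pi> i y)"
      by simp_all
    \<comment> \<open>In \<open>H n\<close> the first \<open>n\<close> functions have been
      exchanged: \<open>H 0\<close> is the original family, and \<open>H r\<close> is the final one
      on all indices below \<open>r\<close>.\<close>
    define H where "H n j = (if j < n then \<psi> j else \<phi> j)" for n j
    have H: "H n j \<in> borel_measurable (fst (X j))" "\<exists>B. \<forall>x\<in>space (fst (X j)). \<bar>H n j x\<bar> \<le> B"
      if "j < r" for n j
      using \<phi>[OF that] \<psi>[OF that] by (auto simp: H_def)
    have step: "(\<integral>y. (\<Prod>j<r. H 0 j (\<pi> j y)) \<partial>fst Y) = (\<integral>y. (\<Prod>j<r. H n j (\<pi> j y)) \<partial>fst Y)"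
      if "n \<le> r" for n
      using that
    proof (induction n)
      case (Suc n)
      then have n: "n < r" by simp
      \<comment> \<open>Away from index \<open>n\<close> the families \<open>H n\<close> and
        \<open>H (Suc n)\<close> agree, so the two products differ in a single factor.\<close>
      have split: "(\<Prod>j<r. H m j (\<pi> j y)) = (\<Prod>j\<in>{..<r} - {n}. H n j (\<pi> j y)) * H m n (\<pi> n y)"
        if "m = n \<or> m = Suc n" for m y
      proof -
        have "(\<Prod>j<r. H m j (\<pi> j y)) = H m n (\<pi> n y) * (\<Prod>j\<in>{..<r} - {n}. H m j (\<pi> j y))"
          using n by (intro prod.remove) auto
        also have "(\<Prod>j\<in>{..<r} - {n}. H m j (\<pi> j y)) = (\<Prod>j\<in>{..<r} - {n}. H n j (\<pi> j y))"
          using that by (intro prod.cong) (auto simp: H_def)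
        finally show ?thesis by (simp add: mult.commute)
      qed
      have "(\<integral>y. (\<Prod>j\<in>{..<r} - {n}. H n j (\<pi> j y)) * \<phi> n (\<pi> n y) \<partial>fst Y)
        = (\<integral>y. (\<Prod>j\<in>{..<r} - {n}. H n j (\<pi> j y)) * \<psi> n (\<pi> n y) \<partial>fst Y)"
        using \<phi>[OF n] \<psi>[OF n] \<psi>\<phi>[OF n] H by (intro sated_joining_step[OF assms n]) auto
      then show ?case
        using Suc by (simp add: split) (simp add: H_def)
    qed simp
    have \<pi>\<psi>: "(\<lambda>y. \<psi> i (\<pi> i y)) \<in> borel_measurable (fst Y)" if "i < r" for i
      by (rule measurable_compose[OF \<pi>m[OF that] \<psi>(1)[OF that]])
    have "(\<integral>y. (\<Prod>i<r. f i y) \<partial>fst Y) = (\<integral>y. (\<Prod>j<r. H 0 j (\<pi> j y)) \<partial>fst Y)"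
      using f\<phi> by (intro Bochner_Integration.integral_cong prod.cong) (auto simp: H_def)
    also have "\<dots> = (\<integral>y. (\<Prod>j<r. \<psi> j (\<pi> j y)) \<partial>fst Y)"
      unfolding step[OF order_refl]
      by (intro Bochner_Integration.integral_cong prod.cong) (auto simp: H_def)
    also have "\<dots> = (\<integral>y. (\<Prod>i<r. real_cond_exp (fst Y) (?V i (?\<Xi> i)) (f i) y) \<partial>fst Y)"
    proof (rule integral_cong_AE)
      have "AE y in fst Y. \<forall>i\<in>{..<r}. real_cond_exp (fst Y) (?V i (?\<Xi> i)) (f i) y = \<psi> i (\<pi> i y)"
        using f\<psi> by (intro AE_finite_allI) auto
      then show "AE y in fst Y. (\<Prod>j<r. \<psi> j (\<pi> j y)) = (\<Prod>i<r. real_cond_exp (fst Y) (?V i (?\<Xi> i)) (f i) y)"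
        by eventually_elim (auto intro: prod.cong)
    qed (auto intro!: borel_measurable_prod \<pi>\<psi>)
    finally show "(\<integral>y. (\<Prod>i<r. f i y) \<partial>fst Y)
      = (\<integral>y. (\<Prod>i<r. real_cond_exp (fst Y) (?V i (?\<Xi> i)) (f i) y) \<partial>fst Y)" .
  qed
qed

end
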